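(* For each positive integer $n$ there exists a set $A_n\subset\{0,1,2\}^n\subset\mathbb{Z}^n$ such that, as $n\to\infty$, $d_d(A_n)=n\log_4 n\,(1+o(1))$ and \[ \frac{d_s(A_n)}{d_d^-(A_n)}\leq\frac{1}{\log_4 d_d(A_n)}\big(1+o(1)\big). \]
   Context: Sets are viewed as additive sets in the abelian group $\mathbb{Z}^n$. A set $D$ is dissociated if its subset sums are pairwise distinct, equivalently the only combination $\sum_{x\in D}\varepsilon_x x$ with $\varepsilon_x\in\{-1,0,1\}$ equal to $0$ is the trivial one. $D\subset A$ is a maximal dissociated subset of $A$ if no dissociated $D'\subset A$ strictly contains $D$. $d_d(A)=\max\{|D|:D\subset A\text{ dissociated}\}$ and $d_d^-(A)=\min\{|D|: D\subset A\text{ maximal dissociated}\}$. The 1-span $\langle S\rangle$ of $S$ is the set of all sums $\sum_{s\in S}\varepsilon_s s$ with $\varepsilon_s\in\{-1,0,1\}$, and $d_s(A)=\min\{|S|: S\subset A,\ \langle S\rangle\supset A\}$. *)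

theory Defs
  imports
    Complex_Main
    "HOL-Library.Function_Algebras"
    "HOL-Library.Landau_Symbols"
begin

text \<open>
  The group $\mathbb{Z}^n$ is the subgroup of the pointwise additive group
  \<^typ>\<open>nat \<Rightarrow> int\<close> consisting of the functions that vanish at all indices \<open>i \<ge> n\<close>.
  The notions below only involve sums and small integer multiples of elements of the given
  set, so they do not depend on \<open>n\<close>.
\<close>

definition cube012 :: "nat \<Rightarrow> (nat \<Rightarrow> int) set" where
  "cube012 n = {x. (\<forall>i<n. x i \<in> {0, 1, 2}) \<and> (\<forall>i\<ge>n. x i = 0)}"

definition dissociated :: "(nat \<Rightarrow> int) set \<Rightarrow> bool" where
  "dissociated D \<longleftrightarrow> inj_on (\<lambda>S. \<Sum>x\<in>S. x) (Fpow D)"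

definition maximal_dissociated :: "(nat \<Rightarrow> int) set \<Rightarrow> (nat \<Rightarrow> int) set \<Rightarrow> bool" where
  "maximal_dissociated D A \<longleftrightarrow>
     D \<subseteq> A \<and> dissociated D \<and> \<not> (\<exists>D'. D' \<subseteq> A \<and> dissociated D' \<and> D \<subset> D')"

text \<open>Intended for finite \<open>S\<close>.\<close>

definition one_span :: "(nat \<Rightarrow> int) set \<Rightarrow> (nat \<Rightarrow> int) set" where
  "one_span S =
     {(\<Sum>s\<in>S. (\<lambda>i. \<epsilon> s * s i)) | \<epsilon> :: (nat \<Rightarrow> int) \<Rightarrow> int. \<forall>s\<in>S. \<epsilon> s \<in> {-1, 0, 1}}"

text \<open>
  The following are intended for finite \<open>A\<close>, where the sets of cardinalities are finite and
  nonempty.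
\<close>

definition d_d :: "(nat \<Rightarrow> int) set \<Rightarrow> nat" where
  "d_d A = Max {card D | D. D \<subseteq> A \<and> dissociated D}"

definition d_d_minus :: "(nat \<Rightarrow> int) set \<Rightarrow> nat" where
  "d_d_minus A = Min {card D | D. maximal_dissociated D A}"

definition d_s :: "(nat \<Rightarrow> int) set \<Rightarrow> nat" where
  "d_s A = Min {card S | S. S \<subseteq> A \<and> A \<subseteq> one_span S}"

end

theory Submission
  imports Defs "HOL-Real_Asymp.Real_Asymp"
begin

text \<open>
  Take \<open>A\<close> to consist of the all-ones vector, the unit vectors and a dissociated set \<open>D\<close> of
  vectors with entries in \<open>{0, 2}\<close>. The first \<open>n + 1\<close> vectors already 1-span \<open>{0, 1, 2}^n\<close>.
  Modulo 2, a relation with coefficients in \<open>{-1, 0, 1}\<close> among elements of \<open>A\<close> either lives on \<open>D\<close>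
  or involves the all-ones vector and every unit vector. As these are dependent, adjoining \<open>D\<close> to
  a dissociated subset of \<open>A\<close> never destroys dissociativity, so every maximal dissociated subset
  contains \<open>D\<close>. A set \<open>D\<close> of size about \<open>n log\<^sub>4 n\<close> comes from a coin-weighing matrix: if the
  columns of the \<open>n \<times> m\<close> matrix \<open>M\<close> over \<open>{0, 1}\<close> are dissociated, then so are those of the
  \<open>(2n + 1) \<times> (2m + n)\<close> matrix with block rows \<open>(M, M, I)\<close>, \<open>(M, J - M, 0)\<close>, \<open>(0, 1, 0)\<close>,
  where \<open>J\<close> is the all-ones matrix.
\<close>

section \<open>Dissociativity as the absence of signed relations\<close>

lemma sum_fun_apply: "(\<Sum>x\<in>S. f x) i = (\<Sum>x\<in>S. f x i)"
  for f :: "'a \<Rightarrow> 'b \<Rightarrow> 'c::comm_monoid_add"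
  by (induction S rule: infinite_finite_induct) auto

text \<open>A signed relation is an equality of two subset sums: the elements with coefficient 1
  against those with coefficient -1. Conversely, equal sums over \<open>S\<close> and
  \<open>T\<close> give a relation whose coefficients are the difference of the two indicator
  functions.\<close>

lemma dissociated_iff:
  assumes "finite D"
  shows "dissociated D \<longleftrightarrow>
    (\<forall>c. (\<forall>x\<in>D. c x \<in> {-1, 0, 1}) \<longrightarrow> (\<forall>i. (\<Sum>x\<in>D. c x * x i) = 0) \<longrightarrow> (\<forall>x\<in>D. c x = 0))"
    (is "_ = ?R")
proof
  assume D: "dissociated D"
  show ?R
  proof (intro allI impI)
    fix c :: "(nat \<Rightarrow> int) \<Rightarrow> int"
    assume c: "\<forall>x\<in>D. c x \<in> {-1, 0, 1}" and eq: "\<forall>i. (\<Sum>x\<in>D. c x * x i) = 0"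
    let ?P = "{x\<in>D. c x = 1}" and ?N = "{x\<in>D. c x = -1}"
    have "(\<Sum>x\<in>?P. x) = (\<Sum>x\<in>?N. x)"
    proof
      fix i
      have "0 = (\<Sum>x\<in>D. c x * x i)" using eq by simp
      also have "\<dots> = (\<Sum>x\<in>D. (if c x = 1 then x i else 0) - (if c x = -1 then x i else 0))"
        using c by (intro sum.cong) auto
      also have "\<dots> = (\<Sum>x\<in>?P. x i) - (\<Sum>x\<in>?N. x i)"
        using assms by (simp add: sum_subtractf sum.inter_filter)
      finally show "(\<Sum>x\<in>?P. x) i = (\<Sum>x\<in>?N. x) i" by (simp add: sum_fun_apply)
    qed
    moreover have "?P \<in> Fpow D" "?N \<in> Fpow D" using assms by (auto simp: Fpow_def)
    ultimately have "?P = ?N" using D unfolding dissociated_def by (meson inj_onD)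
    then have "?P = {}" "?N = {}" by auto
    then show "\<forall>x\<in>D. c x = 0" using c by blast
  qed
next
  assume R: ?R
  show "dissociated D"
    unfolding dissociated_def
  proof (rule inj_onI)
    fix S T assume ST: "S \<in> Fpow D" "T \<in> Fpow D" and eq: "(\<Sum>x\<in>S. x) = (\<Sum>x\<in>T. x)"
    then have sub: "S \<subseteq> D" "T \<subseteq> D" by (auto simp: Fpow_def)
    let ?c = "\<lambda>x. (if x \<in> S then 1 else 0) - (if x \<in> T then 1 else 0) :: int"
    have "\<forall>i. (\<Sum>x\<in>D. ?c x * x i) = 0"
    proof
      fix i
      have "(\<Sum>x\<in>D. ?c x * x i) =
          (\<Sum>x\<in>D. (if x \<in> S then x i else 0) - (if x \<in> T then x i else 0))"
        by (intro sum.cong) auto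
      also have "\<dots> = (\<Sum>x\<in>S. x i) - (\<Sum>x\<in>T. x i)"
        using assms sub by (simp add: sum_subtractf sum.If_cases Int_absorb1)
      also have "\<dots> = 0" using fun_cong[OF eq, of i] by (simp add: sum_fun_apply)
      finally show "(\<Sum>x\<in>D. ?c x * x i) = 0" .
    qed
    moreover have "\<forall>x\<in>D. ?c x \<in> {-1, 0, 1}" by auto
    ultimately have "\<forall>x\<in>D. ?c x = 0" using R[THEN spec, of ?c] by satx
    then show "S = T" using sub by (auto split: if_splits)
  qed
qed

lemma dissociatedD:
  assumes "dissociated D" "finite D" "\<And>x. x \<in> D \<Longrightarrow> c x \<in> {-1, 0, 1}"
    "\<And>i. (\<Sum>x\<in>D. c x * x i) = 0" "x \<in> D"
  shows "c x = 0"
proof -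
  have "\<forall>x\<in>D. c x \<in> {-1, 0, 1}" "\<forall>i. (\<Sum>x\<in>D. c x * x i) = 0"
    using assms(3,4) by blast+
  then have "\<forall>x\<in>D. c x = 0"
    by (rule assms(1)[unfolded dissociated_iff[OF assms(2)], THEN spec, THEN mp, THEN mp])
  then show ?thesis using assms(5) by (rule bspec)
qed

lemma dissociated_subset: "dissociated D \<Longrightarrow> S \<subseteq> D \<Longrightarrow> dissociated S"
  unfolding dissociated_def by (meson Fpow_mono inj_on_subset)

lemma dissociated_empty: "dissociated {}"
  by (auto simp: dissociated_def Fpow_def inj_on_def)

section \<open>One-sided bounds for the extremal cardinalities\<close>

lemma d_d_le:
  assumes "finite A"
  shows "d_d A \<le> card A"
proof -
  have "finite {card D |D. D \<subseteq> A \<and> dissociated D}"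
    by (rule finite_subset[of _ "{..card A}"]) (auto intro: card_mono[OF assms])
  then show ?thesis
    unfolding d_d_def using dissociated_empty by (subst Max_le_iff) (auto intro: card_mono[OF assms])
qed

lemma le_d_d:
  assumes "finite A" "D \<subseteq> A" "dissociated D"
  shows "card D \<le> d_d A"
proof -
  have "finite {card D |D. D \<subseteq> A \<and> dissociated D}"
    by (rule finite_subset[of _ "{..card A}"]) (auto intro: card_mono[OF assms(1)])
  then show ?thesis unfolding d_d_def using assms by (intro Max_ge) auto
qed

text \<open>Ensures that the minimum in \<open>d_d_minus\<close> is taken over a nonempty
  set.\<close>

lemma ex_maximal_dissociated:
  assumes "finite A"
  shows "\<exists>M. maximal_dissociated M A"
proof -
  let ?F = "{D. D \<subseteq> A \<and> dissociated D}"
  have "finite ?F" using assms by simp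
  moreover have "?F \<noteq> {}" using dissociated_empty by blast
  ultimately obtain M where "M \<in> ?F" "\<forall>D\<in>?F. M \<subseteq> D \<longrightarrow> M = D"
    using finite_has_maximal[of ?F] by blast
  then show ?thesis unfolding maximal_dissociated_def by blast
qed

lemma le_d_d_minus:
  assumes "finite A" "\<And>M. maximal_dissociated M A \<Longrightarrow> m \<le> card M"
  shows "m \<le> d_d_minus A"
proof -
  have "finite {card M |M. maximal_dissociated M A}"
    by (rule finite_subset[of _ "{..card A}"])
      (auto simp: maximal_dissociated_def intro: card_mono[OF assms(1)])
  then show ?thesis
    unfolding d_d_minus_def using assms ex_maximal_dissociated[of A]
    by (subst Min_ge_iff) auto
qed

lemma d_s_le:
  assumes "finite A" "S \<subseteq> A" "A \<subseteq> one_span S"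
  shows "d_s A \<le> card S"
proof -
  have "finite {card S |S. S \<subseteq> A \<and> A \<subseteq> one_span S}"
    by (rule finite_subset[of _ "{..card A}"]) (auto intro: card_mono[OF assms(1)])
  then show ?thesis unfolding d_s_def using assms by (intro Min_le) auto
qed

section \<open>Coin-weighing matrices with about n log_4 n columns\<close>

text \<open>Here \<open>v j i\<close> is the entry in column \<open>j\<close> and row \<open>i\<close> of an \<open>n \<times> m\<close> matrix.\<close>

definition detecting :: "nat \<Rightarrow> nat \<Rightarrow> (nat \<Rightarrow> nat \<Rightarrow> int) \<Rightarrow> bool" where
  "detecting n m v \<longleftrightarrow> (\<forall>j i. v j i \<in> {0, 1}) \<and>
    (\<forall>c. (\<forall>j<m. c j \<in> {-1, 0, 1}) \<longrightarrow> (\<forall>i<n. (\<Sum>j<m. c j * v j i) = 0) \<longrightarrow> (\<forall>j<m. c j = 0))"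

lemma detectingD:
  assumes "detecting n m v" "\<And>j. j < m \<Longrightarrow> c j \<in> {-1, 0, 1}"
    "\<And>i. i < n \<Longrightarrow> (\<Sum>j<m. c j * v j i) = 0" "j < m"
  shows "c j = 0"
proof -
  have "\<forall>j<m. c j \<in> {-1, 0, 1}" "\<forall>i<n. (\<Sum>j<m. c j * v j i) = 0"
    using assms(2,3) by blast+
  then have "\<forall>j<m. c j = 0"
    by (rule assms(1)[unfolded detecting_def, THEN conjunct2, THEN spec, THEN mp, THEN mp])
  then show ?thesis using assms(4) by blast
qed

lemma detecting_0: "detecting n 0 (\<lambda>_ _. 0)"
  by (simp add: detecting_def)

lemma detecting_mono:
  assumes v: "detecting n m v" and "n \<le> n'" "m' \<le> m"
  shows "detecting n' m' v"
  unfolding detecting_def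
proof (intro conjI allI impI)
  show "v j i \<in> {0, 1}" for j i using v unfolding detecting_def by blast
  fix c :: "nat \<Rightarrow> int" and j
  assume c: "\<forall>j<m'. c j \<in> {-1, 0, 1}" and eq: "\<forall>i<n'. (\<Sum>j<m'. c j * v j i) = 0" and j: "j < m'"
  let ?c = "\<lambda>j. if j < m' then c j else 0"
  have "(\<Sum>j<m. ?c j * v j i) = (\<Sum>j<m'. c j * v j i)" for i
    using assms(3) by (intro sum.mono_neutral_cong_right) auto
  then have "?c j = 0"
    using c eq j assms(2,3) by (intro detectingD[OF v, of ?c]) auto
  then show "c j = 0" using j by simp
qed

lemma sum_lessThan_add: "(\<Sum>j<m + k. f j) = (\<Sum>j<m. f j) + (\<Sum>j<k. f (m + j))"
  for f :: "nat \<Rightarrow> 'a::comm_monoid_add"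
  by (induction k) (auto simp: add.assoc)

lemma detecting_double:
  assumes v: "detecting n m v"
  shows "\<exists>w. detecting (2 * n + 1) (2 * m + n) w"
proof -
  define w :: "nat \<Rightarrow> nat \<Rightarrow> int" where "w j i =
    (if i < n then (if j < m then v j i else if j < 2 * m then v (j - m) i else of_bool (j - 2 * m = i))
     else if i < 2 * n then
       (if j < m then v j (i - n) else if j < 2 * m then 1 - v (j - m) (i - n) else 0)
     else of_bool (m \<le> j \<and> j < 2 * m))" for j i
  have v01: "v j i \<in> {0, 1}" for j i using v unfolding detecting_def by blast
  have "detecting (2 * n + 1) (2 * m + n) w"
    unfolding detecting_def
  proof (intro conjI)
    show "\<forall>j i. w j i \<in> {0, 1}"
    proof (intro allI)
      fix j i
      show "w j i \<in> {0, 1}"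
        using v01[of j i] v01[of "j - m" i] v01[of j "i - n"] v01[of "j - m" "i - n"]
        unfolding w_def by auto
    qed
    show "\<forall>c. (\<forall>j<2 * m + n. c j \<in> {-1, 0, 1}) \<longrightarrow>
        (\<forall>i<2 * n + 1. (\<Sum>j<2 * m + n. c j * w j i) = 0) \<longrightarrow> (\<forall>j<2 * m + n. c j = 0)"
    proof (intro allI impI)
      fix c :: "nat \<Rightarrow> int" and j
      assume c: "\<forall>j<2 * m + n. c j \<in> {-1, 0, 1}"
        and eq: "\<forall>i<2 * n + 1. (\<Sum>j<2 * m + n. c j * w j i) = 0" and j: "j < 2 * m + n"
      have split: "(\<Sum>j<2 * m + n. c j * w j i) = (\<Sum>j<m. c j * w j i)
          + (\<Sum>j<m. c (m + j) * w (m + j) i) + (\<Sum>j<n. c (2 * m + j) * w (2 * m + j) i)" for i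
        using sum_lessThan_add[of "\<lambda>j. c j * w j i" "2 * m" n]
          sum_lessThan_add[of "\<lambda>j. c j * w j i" m m] by (simp add: mult_2)
      define a b where "a i = (\<Sum>j<m. c j * v j i)" and "b i = (\<Sum>j<m. c (m + j) * v j i)" for i
      have r1: "a i + b i + c (2 * m + i) = 0" if "i < n" for i
        using eq[rule_format, of i] that unfolding split
        by (simp add: w_def a_def b_def)
      \<comment> \<open>The last row forces the middle coefficients to sum to zero, so in
        \<open>r2\<close> the block J - M acts as -M.\<close>
      have r3: "(\<Sum>j<m. c (m + j)) = 0"
        using eq[rule_format, of "2 * n"] unfolding split by (simp add: w_def)
      have r2: "a i = b i" if "i < n" for i
        using eq[rule_format, of "n + i"] that r3 unfolding split
        by (simp add: w_def a_def b_def right_diff_distrib sum_subtractf)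
      have last: "c (2 * m + i) = 0" if "i < n" for i
      proof -
        \<comment> \<open>\<open>r1\<close> and \<open>r2\<close> express this coefficient as \<open>-2 a i\<close>\<close>
        have "even (c (2 * m + i))" using r1[OF that] r2[OF that] by presburger
        then show ?thesis using c[rule_format, of "2 * m + i"] that by auto
      qed
      then have ab: "a i = 0" "b i = 0" if "i < n" for i
        using r1[OF that] r2[OF that] that by auto
      have first: "c j = 0" if "j < m" for j
        by (rule detectingD[OF v _ _ that]) (use c ab(1) in \<open>auto simp: a_def\<close>)
      have second: "c (m + j) = 0" if "j < m" for j
        by (rule detectingD[OF v _ _ that, of "\<lambda>j. c (m + j)"]) (use c ab(2) in \<open>auto simp: b_def\<close>)
      consider "j < m" | "m \<le> j" "j < 2 * m" | "2 * m \<le> j" by linarith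
      then show "c j = 0"
        using first second[of "j - m"] last[of "j - 2 * m"] j by cases auto
    qed
  qed
  then show ?thesis by blast
qed

text \<open>For even \<open>n\<close> the doubled matrix has only \<open>n - 1\<close> rows; one
  spare row is then added by \<open>detecting_mono\<close>.\<close>

lemma ex_detecting_step:
  assumes "detecting ((n - 1) div 2) m v" "n > 0"
  shows "\<exists>w. detecting n (2 * m + (n - 1) div 2) w"
proof -
  obtain w where "detecting (2 * ((n - 1) div 2) + 1) (2 * m + (n - 1) div 2) w"
    using detecting_double[OF assms(1)] by blast
  then have "detecting n (2 * m + (n - 1) div 2) w"
    by (rule detecting_mono) (use assms(2) in auto)
  then show ?thesis by blast
qed

text \<open>Each doubling step halves \<open>n\<close> to \<open>h = (n - 1) div 2\<close>. The
  shift by 2 absorbs the rounding, since \<open>n + 2\<close> is at most \<open>2 * (h + 2)\<close>.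
  The constant 4 reproduces itself: twice 4 plus \<open>2 * h\<close>, from the new columns, is
  \<open>2 * (h + 2) + 4\<close>. The base case doubles the empty matrix, and
  \<open>n \<ge> 6\<close> gives the two columns it needs.\<close>

lemma ex_detecting_power:
  "2 ^ (k + 3) \<le> n + 2 \<Longrightarrow> \<exists>m v. detecting n m v \<and> k * (n + 2) + 4 \<le> 2 * m"
proof (induction k arbitrary: n)
  case 0
  then have "n \<ge> 6" by simp
  then show ?case
    using ex_detecting_step[OF detecting_0, of n] by (intro exI[of _ "(n - 1) div 2"]) auto
next
  case (Suc k)
  define h where "h = (n - 1) div 2"
  have h: "n + 2 \<le> 2 * (h + 2)" unfolding h_def by presburger
  have "2 * 2 ^ (k + 3) \<le> n + 2" using Suc.prems by (simp add: power_add)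
  then have "2 * 2 ^ (k + 3) \<le> 2 * (h + 2)" using h by (rule order_trans)
  then have "2 ^ (k + 3) \<le> h + 2" by simp
  then obtain m v where m: "detecting h m v" "k * (h + 2) + 4 \<le> 2 * m"
    using Suc.IH by blast
  have "(2::nat) ^ 3 \<le> 2 ^ (Suc k + 3)" by (intro power_increasing) auto
  then have "n > 0" using Suc.prems by simp
  then obtain w where "detecting n (2 * m + h) w"
    using ex_detecting_step m(1) unfolding h_def by blast
  moreover have "Suc k * (n + 2) + 4 \<le> 2 * (2 * m + h)"
  proof -
    have "Suc k * (n + 2) \<le> Suc k * (2 * (h + 2))" using h by (intro mult_le_mono) auto
    also have "\<dots> = 2 * (k * (h + 2)) + 2 * (h + 2)" by (simp add: algebra_simps)
    finally show ?thesis using m(2) by (simp add: algebra_simps)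
  qed
  ultimately show ?case by blast
qed

text \<open>This is n log_4 n - 2n rounded down, with \<open>nat\<close> replacing negative values
  by 0. The loss of 2n is of lower order.\<close>

definition detect_size :: "nat \<Rightarrow> nat" where
  "detect_size n = nat \<lfloor>real n / 2 * (log 2 (real n) - 4)\<rfloor>"

lemma ex_detecting: "\<exists>v. detecting n (detect_size n) v"
proof (cases "n < 16")
  case True
  have "log 2 (real n) \<le> 4"
  proof (cases "n = 0")
    case False
    then show ?thesis using True by (simp add: log_le_iff)
  qed (simp add: log_def)
  then have "detect_size n = 0"
    using mult_nonneg_nonpos[of "real n" "log 2 (real n) - 4"] unfolding detect_size_def by simp
  then show ?thesis using detecting_0 by auto
next
  case False
  \<comment> \<open>The lemma on powers is applied with \<open>k - 3\<close>. Of the 4 subtracted in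
    \<open>detect_size\<close>, 3 pays for this shift and 1 for rounding the logarithm down.\<close>
  define k where "k = nat \<lfloor>log 2 (real n)\<rfloor>"
  have "log 2 (real n) \<ge> 4" using False by (simp add: le_log_iff)
  then have k: "real k \<le> log 2 (real n)" "log 2 (real n) < real k + 1" "k \<ge> 4"
    unfolding k_def by (auto simp: le_nat_iff le_floor_iff)
  have "real (2 ^ k) \<le> real n"
    using k(1) False by (simp add: le_log_iff powr_realpow)
  then have "2 ^ (k - 3 + 3) \<le> n + 2" using k(3) by (simp add: of_nat_le_iff del: of_nat_power)
  then obtain m v where m: "detecting n m v" "(k - 3) * (n + 2) + 4 \<le> 2 * m"
    using ex_detecting_power by blast
  have "real n / 2 * (log 2 (real n) - 4) \<le> real n / 2 * (real k - 3)"
    using k by (intro mult_left_mono) auto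
  also have "\<dots> \<le> real m"
  proof -
    have "(k - 3) * n \<le> (k - 3) * (n + 2)" by simp
    then have "(k - 3) * n \<le> 2 * m" using m(2) by linarith
    then have "real ((k - 3) * n) \<le> real (2 * m)" by (simp only: of_nat_le_iff)
    then show ?thesis using k(3) by (simp add: of_nat_diff algebra_simps)
  qed
  finally have "detect_size n \<le> m"
    unfolding detect_size_def by linarith
  then show ?thesis using detecting_mono[OF m(1)] by blast
qed

text \<open>The factor 2 leaves the relations between columns unchanged and makes all entries even,
  as the later parity argument requires. Two equal columns would satisfy a relation with
  coefficients 1 and -1, so no column is lost in passing to a set.\<close>

lemma dissociated_detecting:
  assumes v: "detecting n m v"
  defines "f \<equiv> \<lambda>j i. if i < n then 2 * v j i else 0"
  shows "dissociated (f ` {..<m})" "card (f ` {..<m}) = m"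
proof -
  have inj: "inj_on f {..<m}"
  proof (rule inj_onI, rule ccontr)
    fix j k assume jk: "j \<in> {..<m}" "k \<in> {..<m}" "f j = f k" "j \<noteq> k"
    let ?c = "\<lambda>l. of_bool (l = j) - of_bool (l = k) :: int"
    have vjk: "v j i = v k i" if "i < n" for i using fun_cong[OF jk(3), of i] that by (simp add: f_def)
    have "(\<Sum>l<m. ?c l * v l i) = 0" if "i < n" for i
      using vjk[OF that] jk(1,2) by (simp add: left_diff_distrib sum_subtractf)
    then have "?c j = 0" using jk(1) by (intro detectingD[OF v, of ?c]) auto
    then show False using jk(4) by simp
  qed
  then show "card (f ` {..<m}) = m" by (simp add: card_image)
  show "dissociated (f ` {..<m})"
    unfolding dissociated_iff[OF finite_imageI[OF finite_lessThan]]
  proof (intro allI impI)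
    fix c :: "(nat \<Rightarrow> int) \<Rightarrow> int"
    assume c: "\<forall>x\<in>f ` {..<m}. c x \<in> {-1, 0, 1}"
      and eq: "\<forall>i. (\<Sum>x\<in>f ` {..<m}. c x * x i) = 0"
    have "(\<Sum>j<m. c (f j) * v j i) = 0" if "i < n" for i
    proof -
      have "2 * (\<Sum>j<m. c (f j) * v j i) = (\<Sum>j<m. c (f j) * f j i)"
        using that by (simp add: f_def sum_distrib_left mult.left_commute)
      also have "\<dots> = 0" using eq[rule_format, of i] by (simp add: sum.reindex[OF inj])
      finally show ?thesis by simp
    qed
    then have "c (f j) = 0" if "j < m" for j
      using c that by (intro detectingD[OF v, of "\<lambda>j. c (f j)"]) auto
    then show "\<forall>x\<in>f ` {..<m}. c x = 0" by blast
  qed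
qed

section \<open>The small spanning set of unit vectors and the all-ones vector\<close>

definition unit_vec :: "nat \<Rightarrow> nat \<Rightarrow> int" where
  "unit_vec j i = of_bool (i = j)"

definition ones_vec :: "nat \<Rightarrow> nat \<Rightarrow> int" where
  "ones_vec n i = of_bool (i < n)"

definition frame :: "nat \<Rightarrow> (nat \<Rightarrow> int) set" where
  "frame n = insert (ones_vec n) (unit_vec ` {..<n})"

lemma inj_unit_vec: "inj unit_vec"
  by (rule injI) (metis unit_vec_def of_bool_eq_iff)

lemma finite_frame: "finite (frame n)"
  by (simp add: frame_def)

lemma card_frame_le: "card (frame n) \<le> n + 1"
  using card_insert_le_m1[of "n + 1" "unit_vec ` {..<n}" "ones_vec n"]
    card_image_le[of "{..<n}" unit_vec] by (simp add: frame_def)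

text \<open>For \<open>n = 1\<close> the all-ones vector is itself a unit vector; this is where
  \<open>n \<ge> 2\<close> enters.\<close>

lemma ones_vec_neq:
  assumes "n \<ge> 2"
  shows "unit_vec j \<noteq> ones_vec n"
proof
  assume "unit_vec j = ones_vec n"
  then have "unit_vec j 0 = ones_vec n 0" "unit_vec j 1 = ones_vec n 1" by simp_all
  then show False using assms by (auto simp: ones_vec_def unit_vec_def)
qed

lemma sum_frame:
  assumes "n \<ge> 2"
  shows "(\<Sum>x\<in>frame n. c x * x i) =
    (if i < n then c (ones_vec n) + c (unit_vec i) else (0::int))"
proof -
  have "(\<Sum>x\<in>frame n. c x * x i) =
      c (ones_vec n) * ones_vec n i + (\<Sum>j<n. c (unit_vec j) * unit_vec j i)"
    unfolding frame_def using ones_vec_neq[OF assms, symmetric]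
    by (subst sum.insert) (auto simp: sum.reindex[OF inj_on_subset[OF inj_unit_vec]])
  also have "(\<Sum>j<n. c (unit_vec j) * unit_vec j i) = (if i < n then c (unit_vec i) else 0)"
    by (simp add: unit_vec_def[of _ i])
  finally show ?thesis by (simp add: ones_vec_def[of _ i])
qed

text \<open>Subtracting the all-ones vector shifts entries from {0, 1, 2} to {-1, 0, 1}, which are
  admissible coefficients for the unit vectors.\<close>

lemma cube012_subset_one_span_frame:
  assumes "n \<ge> 2"
  shows "cube012 n \<subseteq> one_span (frame n)"
proof
  fix x assume x: "x \<in> cube012 n"
  \<comment> \<open>Coefficients are indexed by vectors, not by positions; on
    \<open>unit_vec i\<close> the sum picks out \<open>x i - 1\<close>.\<close>
  define c where "c s = (if s = ones_vec n then 1 else (\<Sum>i<n. s i * (x i - 1)))"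
    for s :: "nat \<Rightarrow> int"
  have c: "c (ones_vec n) = 1" "\<And>i. i < n \<Longrightarrow> c (unit_vec i) = x i - 1"
    using ones_vec_neq[OF assms] by (auto simp: c_def unit_vec_def of_bool_def if_distrib[of "\<lambda>t. t * _"] cong: if_cong)
  have "x = (\<Sum>s\<in>frame n. (\<lambda>i. c s * s i))"
    using x by (auto simp: sum_fun_apply sum_frame[OF assms] c cube012_def)
  moreover have "\<forall>s\<in>frame n. c s \<in> {-1, 0, 1}"
    using x by (auto simp: frame_def c cube012_def)
  ultimately show "x \<in> one_span (frame n)" unfolding one_span_def by blast
qed

text \<open>The all-ones vector is the sum of the unit vectors.\<close>

lemma not_dissociated_frame:
  assumes "n \<ge> 2"
  shows "\<not> dissociated (frame n)"
proof
  assume D: "dissociated (frame n)"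
  let ?c = "\<lambda>x. if x = ones_vec n then 1 else -1 :: int"
  have "?c (unit_vec i) = -1" if "i < n" for i using ones_vec_neq[OF assms] by simp
  then have "(\<Sum>x\<in>frame n. ?c x * x i) = 0" for i by (simp add: sum_frame[OF assms])
  then have "?c (ones_vec n) = 0"
    by (intro dissociatedD[OF D finite_frame, of ?c]) (auto simp: frame_def)
  then show False by simp
qed

lemma dissociated_Un_even:
  assumes n: "n \<ge> 2" and D: "finite D" "dissociated D" "\<forall>x\<in>D. \<forall>i. even (x i)"
    and M: "M \<subseteq> frame n \<union> D" "dissociated M"
  shows "dissociated (M \<union> D)"
proof -
  have finM: "finite M" using M(1) D(1) finite_frame finite_subset by blast
  have disj: "frame n \<inter> D = {}"
  proof -
    have "odd (ones_vec n 0)" "odd (unit_vec j j)" for j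
      using n by (auto simp: ones_vec_def unit_vec_def)
    then show ?thesis using D(3) by (fastforce simp: frame_def)
  qed
  show ?thesis
    unfolding dissociated_iff[OF finite_UnI[OF finM D(1)]]
  proof (intro allI impI)
    fix c :: "(nat \<Rightarrow> int) \<Rightarrow> int"
    assume c: "\<forall>x\<in>M \<union> D. c x \<in> {-1, 0, 1}" and eq: "\<forall>i. (\<Sum>x\<in>M \<union> D. c x * x i) = 0"
    \<comment> \<open>Extension by zero turns the relation into one on all of
      \<open>frame n \<union> D\<close>, where the two parts are disjoint and can be
      separated.\<close>
    define e where "e x = (if x \<in> M \<union> D then c x else 0)" for x
    have e: "e x \<in> {-1, 0, 1}" for x using c by (auto simp: e_def)
    have eq': "(\<Sum>x\<in>frame n. e x * x i) + (\<Sum>x\<in>D. e x * x i) = 0" for i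
    proof -
      have "(\<Sum>x\<in>frame n. e x * x i) + (\<Sum>x\<in>D. e x * x i) = (\<Sum>x\<in>frame n \<union> D. e x * x i)"
        using disj D(1) finite_frame by (simp add: sum.union_disjoint)
      also have "\<dots> = (\<Sum>x\<in>M \<union> D. c x * x i)"
        using M(1) D(1) finite_frame
        by (intro sum.mono_neutral_cong_right) (auto simp: e_def)
      finally show ?thesis using eq by simp
    qed
    have parity: "even (e (ones_vec n) + e (unit_vec i))" if "i < n" for i
    proof -
      have "even (\<Sum>x\<in>D. e x * x i)" using D(3) by (intro dvd_sum) auto
      then show ?thesis using eq'[of i] that by (simp add: sum_frame[OF n]) presburger
    qed
    \<comment> \<open>A nonzero coefficient here is odd, so by parity every unit vector has a
      nonzero coefficient too. Being disjoint from \<open>D\<close>, the whole frame would then lie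
      in \<open>M\<close>.\<close>
    have e0: "e (ones_vec n) = 0"
    proof (rule ccontr)
      assume nz: "e (ones_vec n) \<noteq> 0"
      have "e (unit_vec i) \<noteq> 0" if "i < n" for i
        using parity[OF that] e[of "ones_vec n"] nz by auto
      then have "e x \<noteq> 0" if "x \<in> frame n" for x
        using nz that by (auto simp: frame_def)
      then have "frame n \<subseteq> M"
        using disj unfolding e_def by (metis Un_iff disjoint_iff subsetI)
      then show False using M(2) not_dissociated_frame[OF n] dissociated_subset by blast
    qed
    have eu: "e (unit_vec i) = 0" if "i < n" for i
      using parity[OF that] e[of "unit_vec i"] e0 by auto
    have "(\<Sum>x\<in>D. e x * x i) = 0" for i
      using eq'[of i] e0 eu by (simp add: sum_frame[OF n] split: if_splits)
    then have "\<forall>x\<in>D. e x = 0"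
      using dissociatedD[OF D(2,1), of e] e by blast
    then have "\<forall>x\<in>frame n \<union> D. e x = 0" using e0 eu by (auto simp: frame_def)
    then show "\<forall>x\<in>M \<union> D. c x = 0" using M(1) unfolding e_def by (metis Un_iff subsetD)
  qed
qed

lemma frame_Un_even_bounds:
  assumes n: "n \<ge> 2" and D: "D \<subseteq> cube012 n" "finite D" "dissociated D"
    "\<forall>x\<in>D. \<forall>i. even (x i)"
  shows "card D \<le> d_d (frame n \<union> D)" "d_d (frame n \<union> D) \<le> card D + n + 1"
    "card D \<le> d_d_minus (frame n \<union> D)" "d_s (frame n \<union> D) \<le> n + 1"
proof -
  let ?A = "frame n \<union> D"
  have fin: "finite ?A" using D(2) finite_frame by blast
  show "card D \<le> d_d ?A" by (rule le_d_d[OF fin _ D(3)]) simp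
  have "d_d ?A \<le> card ?A" by (rule d_d_le[OF fin])
  also have "\<dots> \<le> card (frame n) + card D" by (rule card_Un_le)
  finally show "d_d ?A \<le> card D + n + 1" using card_frame_le[of n] by linarith
  show "card D \<le> d_d_minus ?A"
  proof (rule le_d_d_minus[OF fin])
    fix M assume M: "maximal_dissociated M ?A"
    then have "dissociated (M \<union> D)"
      using dissociated_Un_even[OF n D(2-4)] unfolding maximal_dissociated_def by blast
    moreover have "M \<subseteq> ?A" "M \<union> D \<subseteq> ?A" using M unfolding maximal_dissociated_def by auto
    \<comment> \<open>Otherwise \<open>M \<union> D\<close> would be a strictly larger dissociated
      subset, against the maximality of \<open>M\<close>.\<close>
    ultimately have "D \<subseteq> M" using M unfolding maximal_dissociated_def by blast
    then show "card D \<le> card M"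
      using \<open>M \<subseteq> ?A\<close> fin by (intro card_mono) (auto intro: finite_subset)
  qed
  have "frame n \<subseteq> cube012 n" by (auto simp: frame_def cube012_def ones_vec_def unit_vec_def)
  then have "?A \<subseteq> one_span (frame n)" using D(1) cube012_subset_one_span_frame[OF n] by blast
  then have "d_s ?A \<le> card (frame n)" by (intro d_s_le[OF fin]) simp_all
  then show "d_s ?A \<le> n + 1" using card_frame_le[of n] by linarith
qed

section \<open>Asymptotic estimates for the constructed sets\<close>

theorem theorem1p5:
  shows "\<exists>A :: nat \<Rightarrow> (nat \<Rightarrow> int) set.
    (\<forall>n\<ge>1. A n \<subseteq> cube012 n) \<and>
    (\<lambda>n. real (d_d (A n))) \<sim>[sequentially] (\<lambda>n. real n * log 4 (real n)) \<and>
    (\<exists>\<epsilon> :: nat \<Rightarrow> real. \<epsilon> \<longlonglongrightarrow> 0 \<and>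
      (\<forall>\<^sub>F n in sequentially.
        real (d_s (A n)) / real (d_d_minus (A n))
          \<le> 1 / log 4 (real (d_d (A n))) * (1 + \<epsilon> n)))"
proof -
  obtain v where v: "\<And>n. detecting n (detect_size n) (v n)"
    using ex_detecting by metis
  define D where "D n = (\<lambda>j i. if i < n then 2 * v n j i else 0) ` {..<detect_size n}" for n
  define A where "A n = frame n \<union> D n" for n
  have v01: "v n j i \<in> {0, 1}" for n j i using v[of n] unfolding detecting_def by blast
  have cube: "D n \<subseteq> cube012 n" for n
    using v01 by (fastforce simp: D_def cube012_def)
  have D: "finite (D n)" "dissociated (D n)" "card (D n) = detect_size n"
    "\<forall>x\<in>D n. \<forall>i. even (x i)" for n
    using dissociated_detecting[OF v[of n]] by (auto simp: D_def)
  note bounds = frame_Un_even_bounds[OF _ cube D(1,2,4), folded A_def, unfolded D(3)]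
  have log4: "log 4 x = log 2 x / 2" for x :: real
    using log_base_pow[of 2 2 x] by simp
  \<comment> \<open>A smooth lower bound for the rounded \<open>detect_size n\<close>; the -1
    accounts for the floor.\<close>
  define L where "L n = real n / 2 * (log 2 (real n) - 4) - 1" for n
  have size: "L n \<le> real (detect_size n)" "real (detect_size n) \<le> L n + 1" if "L n \<ge> 2" for n
    using that unfolding L_def detect_size_def by linarith+
  have L_ge: "\<forall>\<^sub>F n in sequentially. L n \<ge> 2"
    unfolding L_def by real_asymp
  have A_cube: "\<forall>n\<ge>1. A n \<subseteq> cube012 n"
    using cube by (auto simp: A_def frame_def cube012_def ones_vec_def unit_vec_def)
  \<comment> \<open>The upper bound adds \<open>n + 1\<close> for the frame to
    \<open>detect_size n \<le> L n + 1\<close>. The threshold 2 keeps the denominators positive and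
    makes the logarithm of \<open>d_d (A n)\<close> positive.\<close>
  have ev: "\<forall>\<^sub>F n in sequentially. 2 \<le> L n \<and> L n \<le> real (d_d (A n))
      \<and> real (d_d (A n)) \<le> L n + real n + 2
      \<and> L n \<le> real (d_d_minus (A n)) \<and> real (d_s (A n)) \<le> real n + 1"
    using eventually_ge_at_top[of 2] L_ge
  proof eventually_elim
    case (elim n)
    then show ?case using bounds[OF elim(1)] size[OF elim(2)] by linarith
  qed
  have d: "(\<lambda>n. real (d_d (A n))) \<sim>[sequentially] (\<lambda>n. real n * log 4 (real n))"
  proof (rule asymp_equiv_sandwich_real)
    \<comment> \<open>Both bounds differ from n log_4 n by O(n), which is of lower order.\<close>
    show "L \<sim>[sequentially] (\<lambda>n. real n * log 4 (real n))"
      unfolding L_def log4 by real_asymp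
    show "(\<lambda>n. L n + real n + 2) \<sim>[sequentially] (\<lambda>n. real n * log 4 (real n))"
      unfolding L_def log4 by real_asymp
  qed (use ev in \<open>auto elim: eventually_mono\<close>)
  \<comment> \<open>Chosen so that \<open>1 + \<epsilon> n\<close> is the bound
    \<open>(n + 1) / L n\<close> on the quotient, multiplied by the logarithm of the upper bound for
    \<open>d_d (A n)\<close>. The first factor is asymptotic to 1 / log_4 n and the second to log_4
    n.\<close>
  define \<epsilon> where "\<epsilon> n = (real n + 1) / L n * log 4 (L n + real n + 2) - 1" for n
  have "\<epsilon> \<longlonglongrightarrow> 0"
    unfolding \<epsilon>_def L_def log4 by real_asymp
  moreover have "\<forall>\<^sub>F n in sequentially. real (d_s (A n)) / real (d_d_minus (A n))
      \<le> 1 / log 4 (real (d_d (A n))) * (1 + \<epsilon> n)"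
    using ev
  proof eventually_elim
    case (elim n)
    let ?d = "real (d_d (A n))"
    have log_pos: "0 < log 4 ?d" using elim by simp
    have log_le: "log 4 ?d \<le> log 4 (L n + real n + 2)" using elim by simp
    have "real (d_s (A n)) / real (d_d_minus (A n)) \<le> (real n + 1) / L n"
      using elim by (intro frac_le) auto
    also have "\<dots> = (real n + 1) / L n * 1" by simp
    \<comment> \<open>The inserted ratio of logarithms is at least 1; it brings in the actual value
      of \<open>d_d (A n)\<close>.\<close>
    also have "\<dots> \<le> (real n + 1) / L n * (log 4 (L n + real n + 2) / log 4 ?d)"
      using elim log_pos log_le by (intro mult_left_mono) auto
    also have "\<dots> = 1 / log 4 ?d * (1 + \<epsilon> n)" by (simp add: \<epsilon>_def)
    finally show ?case .
  qed
  ultimately show ?thesis using A_cube d by blast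
qed

end
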